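(* Let $A$ be a finite cyclic group, let $B$ be a group, and let $K\subset B$ be a subset. Then the (directed) Cayley graph of the wreath product $A\wr B$ with respect to the set $\widetilde K_+=\{(1,\delta_1^b)\}_{b\in K}\subset A\wr B$ is isomorphic, as a digraph, to the tensor product $\overrightarrow A\otimes\overrightarrow{\mathscr S}_K\left(B^{|A|}\right)$.
   Context: The group $A\cong\mathbb Z_n$, $n=|A|$, is written additively, with distinguished generator $1$. $B$ is a group with identity $e$, written multiplicatively. Let $\mathrm{fun}(A,B)$ be the group of all functions (configurations) $\Phi:A\to B$ with pointwise multiplication. The group $A$ acts on it by automorphisms $(\mathbf T^a\Phi)(x)=\Phi(x-a)$. The wreath product $A\wr B$ is the set $A\times\mathrm{fun}(A,B)$ with multiplication $$(a_1,\Phi_1)\cdot(a_2,\Phi_2)=(a_1+a_2,\ \Phi_1\cdot\mathbf T^{a_1}\Phi_2).$$ For $a\in A$, $b\in B$ the configuration $\delta_a^b$ takes the value $b$ at $a$ and $e$ elsewhere. The (directed) Cayley graph of a group $G$ with respect to a subset $S\subset G$ has vertex set $G$ and arrows $g\to gs$, $g\in G$, $s\in S$ (the set $S$ is not required to generate $G$). The digraph $\overrightarrow A$ is the directed Cayley graph of $A$ with respect to $\{1\}$, i.e. its arrows are $i\to i+1$, $i\in A$. For a group $B$, a subset $K\subset B$ and $n\ge1$, the Cayley circular slider digraph $\overrightarrow{\mathscr S}_K(B^n)$ has vertex set $B^n$ and arrows $$(g_1,g_2,\dots,g_n)\to(g_2,g_3,\dots,g_n,g_1h),\qquad g_i\in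 B,\ h\in K.$$ The tensor (direct) product $\Gamma_1\otimes\Gamma_2$ of two digraphs is the digraph whose vertex set and arrow set are the products of the vertex sets and of the arrow sets of $\Gamma_1$ and $\Gamma_2$, respectively, with the natural incidence: there is an arrow $(x_1,x_2)\to(y_1,y_2)$ for each pair of arrows $x_1\to y_1$ in $\Gamma_1$ and $x_2\to y_2$ in $\Gamma_2$. *)

theory Defs
  imports "HOL-Algebra.Product_Groups" "Graph_Theory.Digraph_Isomorphism"
begin

text \<open>All groups follow the multiplicative notation of HOL-Algebra; for the finite cyclic group
  \<open>A\<close>, usually written additively, \<open>x \<otimes>\<^bsub>A\<^esub> inv\<^bsub>A\<^esub> a\<close> thus stands for \<open>x - a\<close>.\<close>

definition config_group ::
    "('a, 'm) monoid_scheme \<Rightarrow> ('b, 'n) monoid_scheme \<Rightarrow> ('a \<Rightarrow> 'b) monoid" where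
  "config_group A B = product_group (carrier A) (\<lambda>_. B)"

definition translate :: "('a, 'm) monoid_scheme \<Rightarrow> 'a \<Rightarrow> ('a \<Rightarrow> 'b) \<Rightarrow> 'a \<Rightarrow> 'b" where
  "translate A a \<Phi> = (\<lambda>x\<in>carrier A. \<Phi> (x \<otimes>\<^bsub>A\<^esub> inv\<^bsub>A\<^esub> a))"

definition wreath_product ::
    "('a, 'm) monoid_scheme \<Rightarrow> ('b, 'n) monoid_scheme \<Rightarrow> ('a \<times> ('a \<Rightarrow> 'b)) monoid" where
  "wreath_product A B =
    \<lparr>carrier = carrier A \<times> carrier (config_group A B),
     monoid.mult = (\<lambda>(a\<^sub>1, \<Phi>\<^sub>1) (a\<^sub>2, \<Phi>\<^sub>2).
       (a\<^sub>1 \<otimes>\<^bsub>A\<^esub> a\<^sub>2, \<Phi>\<^sub>1 \<otimes>\<^bsub>config_group A B\<^esub> translate A a\<^sub>1 \<Phi>\<^sub>2)),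
     one = (\<one>\<^bsub>A\<^esub>, \<one>\<^bsub>config_group A B\<^esub>)\<rparr>"

definition delta_config ::
    "('a, 'm) monoid_scheme \<Rightarrow> ('b, 'n) monoid_scheme \<Rightarrow> 'a \<Rightarrow> 'b \<Rightarrow> 'a \<Rightarrow> 'b" where
  "delta_config A B a b = (\<lambda>x\<in>carrier A. if x = a then b else \<one>\<^bsub>B\<^esub>)"

text \<open>The arc \<open>g \<rightarrow> g s\<close> is represented by the pair \<open>(g, s)\<close>.\<close>

definition cayley_digraph :: "('g, 'm) monoid_scheme \<Rightarrow> 'g set \<Rightarrow> ('g, 'g \<times> 'g) pre_digraph" where
  "cayley_digraph G S =
    \<lparr>verts = carrier G, arcs = carrier G \<times> S, tail = fst, head = (\<lambda>(g, s). g \<otimes>\<^bsub>G\<^esub> s)\<rparr>"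

text \<open>An element \<open>(g\<^sub>1, \<dots>, g\<^sub>n)\<close> of the \<open>n\<close>-th power of \<open>B\<close> is a list of length \<open>n\<close>, and its arc
  labelled by \<open>h \<in> K\<close> is the pair of this list and \<open>h\<close>. Only \<open>n \<ge> 1\<close> is meaningful.\<close>

definition circular_slider ::
    "('b, 'n) monoid_scheme \<Rightarrow> 'b set \<Rightarrow> nat \<Rightarrow> ('b list, 'b list \<times> 'b) pre_digraph" where
  "circular_slider B K n =
    (let V = {gs. length gs = n \<and> set gs \<subseteq> carrier B}
     in \<lparr>verts = V, arcs = V \<times> K, tail = fst,
         head = (\<lambda>(gs, h). tl gs @ [hd gs \<otimes>\<^bsub>B\<^esub> h])\<rparr>)"

definition tensor_product ::
    "('v, 'e) pre_digraph \<Rightarrow> ('w, 'f) pre_digraph \<Rightarrow> ('v \<times> 'w, 'e \<times> 'f) pre_digraph" where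
  "tensor_product \<Gamma>\<^sub>1 \<Gamma>\<^sub>2 =
    \<lparr>verts = verts \<Gamma>\<^sub>1 \<times> verts \<Gamma>\<^sub>2, arcs = arcs \<Gamma>\<^sub>1 \<times> arcs \<Gamma>\<^sub>2,
     tail = map_prod (tail \<Gamma>\<^sub>1) (tail \<Gamma>\<^sub>2), head = map_prod (head \<Gamma>\<^sub>1) (head \<Gamma>\<^sub>2)\<rparr>"

end

theory Submission
  imports Defs "HOL-Algebra.Multiplicative_Group"
begin

text \<open>Multiplying \<open>(a, \<Phi>)\<close> on the right by \<open>(\<gamma>, \<delta>\<^sub>\<gamma>\<^sup>b)\<close> moves the position
  (the lamplighter) from \<open>a\<close> to \<open>a \<otimes> \<gamma>\<close> and multiplies the single value \<open>\<Phi> (a \<otimes> \<gamma>)\<close> by \<open>b\<close>.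
  Read the configuration once around the circle, in the direction of \<open>\<gamma>\<close> and starting just ahead of the lamplighter: the
  value about to be modified is the first entry. Once the lamplighter has moved
  onto it, the same site is the last one of the new reading, while all other entries keep their values and shift by one place to the left. This
  is exactly an arc of the circular slider, so the map sending \<open>(a, \<Phi>)\<close> to \<open>a\<close> paired with this
  reading is the isomorphism; the first factor of the tensor product records the position, which
  the reading alone forgets.

  The two facts that carry the argument are \<open>wreath_mult_delta\<close>, which computes the step in the
  wreath product, and \<open>orbit_word_step\<close>, which turns it into a slider step. The latter, and the
  fact that readings determine configurations, rest on the powers \<open>\<gamma>\<^sup>0, \<dots>, \<gamma>\<^sup>n\<^sup>-\<^sup>1\<close>
  enumerating the group of order \<open>n\<close> without repetition.\<close>

section \<open>Digraph isomorphisms\<close>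

lemma digraph_isoI:
  assumes "wf_digraph G"
    and "bij_betw f (verts G) (verts H)" and "bij_betw g (arcs G) (arcs H)"
    and "\<And>e. e \<in> arcs G \<Longrightarrow> f (tail G e) = tail H (g e)"
    and "\<And>e. e \<in> arcs G \<Longrightarrow> f (head G e) = head H (g e)"
  shows "digraph_iso G (H :: ('c, 'd) pre_digraph)"
proof -
  (* The incidence functions of H are total and must be matched off its arcs as well, so the
     isomorphism carries those of H itself. *)
  let ?h = "\<lparr>iso_verts = f, iso_arcs = g, iso_head = head H, iso_tail = tail H\<rparr>"
  have "pre_digraph.digraph_isomorphism G ?h"
    using assms by (auto simp: pre_digraph.digraph_isomorphism_def bij_betw_def)
  moreover have "H = app_iso ?h G"
    using assms by (auto simp: app_iso_def bij_betw_def intro: pre_digraph.equality)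
  ultimately show ?thesis
    unfolding digraph_iso_def by blast
qed

section \<open>Readings of configurations\<close>

text \<open>Extensional functions have no data outside \<open>I\<close>, so the list of values is all there is, and
  as no index repeats, every list arises.\<close>

lemma bij_betw_read_along:
  assumes "bij_betw e {..<n} I"
  shows "bij_betw (\<lambda>\<Phi>. map (\<lambda>i. \<Phi> (e i)) [0..<n]) (\<Pi>\<^sub>E x\<in>I. C)
    {gs. length gs = n \<and> set gs \<subseteq> C}"
proof (rule bij_betw_imageI)
  have I: "I = e ` {..<n}" and inj: "inj_on e {..<n}"
    using assms by (auto simp: bij_betw_def)
  show "inj_on (\<lambda>\<Phi>. map (\<lambda>i. \<Phi> (e i)) [0..<n]) (\<Pi>\<^sub>E x\<in>I. C)"
  proof (rule inj_onI)
    fix \<Phi> \<Psi> assume "\<Phi> \<in> (\<Pi>\<^sub>E x\<in>I. C)" "\<Psi> \<in> (\<Pi>\<^sub>E x\<in>I. C)"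
      and "map (\<lambda>i. \<Phi> (e i)) [0..<n] = map (\<lambda>i. \<Psi> (e i)) [0..<n]"
    then show "\<Phi> = \<Psi>"
      by (intro PiE_ext[of \<Phi> I "\<lambda>_. C"]) (auto simp: I)
  qed
  show "(\<lambda>\<Phi>. map (\<lambda>i. \<Phi> (e i)) [0..<n]) ` (\<Pi>\<^sub>E x\<in>I. C) = {gs. length gs = n \<and> set gs \<subseteq> C}"
  proof (intro equalityI subsetI)
    fix gs assume gs: "gs \<in> {gs. length gs = n \<and> set gs \<subseteq> C}"
    define \<Phi> where "\<Phi> = (\<lambda>x\<in>I. gs ! the_inv_into {..<n} e x)"
    have val: "\<Phi> (e i) = gs ! i" if "i < n" for i
      using that by (simp add: \<Phi>_def I the_inv_into_f_f[OF inj])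
    have "\<Phi> \<in> (\<Pi>\<^sub>E x\<in>I. C)"
    proof (rule PiE_I)
      fix x assume "x \<in> I"
      then obtain i where "x = e i" "i < n" by (auto simp: I)
      then show "\<Phi> x \<in> C" using gs val by (auto simp: subset_iff)
    qed (simp add: \<Phi>_def)
    moreover have "gs = map (\<lambda>i. \<Phi> (e i)) [0..<n]"
      using gs val by (intro nth_equalityI) auto
    ultimately show "gs \<in> (\<lambda>\<Phi>. map (\<lambda>i. \<Phi> (e i)) [0..<n]) ` (\<Pi>\<^sub>E x\<in>I. C)"
      by blast
  qed (auto simp: I PiE_iff)
qed

definition orbit_word ::
    "('a, 'm) monoid_scheme \<Rightarrow> 'a \<Rightarrow> 'a \<Rightarrow> ('a \<Rightarrow> 'b) \<Rightarrow> 'b list" where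
  "orbit_word A \<gamma> c \<Phi> = map (\<lambda>i. \<Phi> (c \<otimes>\<^bsub>A\<^esub> \<gamma> [^]\<^bsub>A\<^esub> i)) [0..<order A]"

locale generated_finite_group = group A for A (structure) +
  fixes \<gamma>
  assumes finite_carrier: "finite (carrier A)"
    and generator_closed: "\<gamma> \<in> carrier A"
    and generate_carrier: "generate A {\<gamma>} = carrier A"
begin

lemma ord_generator: "ord \<gamma> = order A"
  using generate_pow_card[OF generator_closed] by (simp add: generate_carrier order_def)

lemma order_pos: "0 < order A"
  using finite_carrier by (simp add: order_gt_0_iff_finite)

lemma bij_betw_generator_powers: "bij_betw (\<lambda>i::nat. \<gamma> [^] i) {..<order A} (carrier A)"
proof -
  have idx: "{0..ord \<gamma> - 1} = {..<order A}"
    using order_pos by (auto simp: ord_generator)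
  have "card ((\<lambda>i::nat. \<gamma> [^] i) ` {..<order A}) = card (carrier A)"
    using card_image[OF ord_inj[OF generator_closed], unfolded idx] by (simp add: order_def)
  then have "(\<lambda>i::nat. \<gamma> [^] i) ` {..<order A} = carrier A"
    using finite_carrier generator_closed by (intro card_subset_eq) auto
  then show ?thesis
    using ord_inj[OF generator_closed, unfolded idx] by (simp add: bij_betw_def)
qed

lemma bij_betw_orbit:
  assumes "c \<in> carrier A"
  shows "bij_betw (\<lambda>i::nat. c \<otimes> \<gamma> [^] i) {..<order A} (carrier A)"
proof -
  have "bij_betw (\<lambda>x. c \<otimes> x) (carrier A) (carrier A)"
    using assms by (simp add: bij_betw_def inj_on_multc inj_on_cmult surj_const_mult)
  from bij_betw_trans[OF bij_betw_generator_powers this] show ?thesis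
    by (simp add: comp_def)
qed

lemma generator_commutes:
  assumes "a \<in> carrier A"
  shows "\<gamma> \<otimes> a = a \<otimes> \<gamma>"
proof -
  obtain i :: nat where "a = \<gamma> [^] i"
    using bij_betw_generator_powers assms by (auto simp: bij_betw_def)
  then show ?thesis
    using generator_closed nat_pow_comm[of \<gamma> 1 i] by simp
qed

lemma bij_betw_orbit_word:
  assumes "c \<in> carrier A"
  shows "bij_betw (orbit_word A \<gamma> c) (\<Pi>\<^sub>E x\<in>carrier A. C)
    {gs. length gs = order A \<and> set gs \<subseteq> C}"
  using bij_betw_read_along[OF bij_betw_orbit[OF assms]]
  unfolding orbit_word_def[abs_def] .

lemma hd_orbit_word:
  assumes "c \<in> carrier A"
  shows "hd (orbit_word A \<gamma> c \<Phi>) = \<Phi> c"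
  using assms order_pos by (simp add: orbit_word_def hd_map)

text \<open>The site \<open>c\<close>, first in the reading that starts at \<open>c\<close>, comes last in the reading that
  starts one step later, because \<open>\<gamma>\<close> has order \<open>n\<close>. As no site is read twice, changing the value
  at \<open>c\<close> affects no other entry.\<close>

lemma orbit_word_step:
  assumes c: "c \<in> carrier A"
  shows "orbit_word A \<gamma> (c \<otimes> \<gamma>) (\<Phi>(c := v)) = tl (orbit_word A \<gamma> c \<Phi>) @ [v]"
proof (rule nth_equalityI)
  show "length (orbit_word A \<gamma> (c \<otimes> \<gamma>) (\<Phi>(c := v))) = length (tl (orbit_word A \<gamma> c \<Phi>) @ [v])"
    using order_pos by (simp add: orbit_word_def)
next
  fix i assume "i < length (orbit_word A \<gamma> (c \<otimes> \<gamma>) (\<Phi>(c := v)))"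
  then have i: "i < order A" by (simp add: orbit_word_def)
  have site: "c \<otimes> \<gamma> \<otimes> \<gamma> [^] i = c \<otimes> \<gamma> [^] Suc i"
    using c generator_closed by (simp add: m_assoc flip: nat_pow_Suc2 del: nat_pow_Suc)
  show "orbit_word A \<gamma> (c \<otimes> \<gamma>) (\<Phi>(c := v)) ! i = (tl (orbit_word A \<gamma> c \<Phi>) @ [v]) ! i"
  proof (cases "Suc i < order A")
    case True
    have "c \<otimes> \<gamma> [^] Suc i \<noteq> c \<otimes> \<gamma> [^] (0::nat)"
      using inj_onD[OF bij_betw_imp_inj_on[OF bij_betw_orbit[OF c]], of "Suc i" 0] True order_pos
      by (auto simp del: nat_pow_Suc nat_pow_0)
    then have "c \<otimes> \<gamma> [^] Suc i \<noteq> c" using c by simp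
    moreover have "i < order A - 1" using True by simp
    ultimately show ?thesis
      using True i by (simp add: orbit_word_def site nth_append nth_tl del: nat_pow_Suc)
  next
    case False
    then have last: "Suc i = order A" using i by simp
    have "c \<otimes> \<gamma> [^] order A = c"
      using c pow_ord_eq_1[OF generator_closed] by (simp add: ord_generator)
    then have "c \<otimes> \<gamma> \<otimes> \<gamma> [^] i = c"
      unfolding site last .
    then show ?thesis
      by (simp add: orbit_word_def nth_append flip: last del: nat_pow_Suc upt_Suc)
  qed
qed

section \<open>Steps in the wreath product\<close>

lemma translate_delta_generator:
  assumes a: "a \<in> carrier A"
  shows "translate A a (delta_config A B \<gamma> b) = delta_config A B (a \<otimes> \<gamma>) b"
proof -
  \<comment> \<open>Translation acts by right multiplication with \<open>inv a\<close>, hence moves the support to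
    \<open>\<gamma> \<otimes> a\<close>; the position of the lamplighter becomes \<open>a \<otimes> \<gamma>\<close>.\<close>
  have "x \<otimes> inv a = \<gamma> \<longleftrightarrow> x = a \<otimes> \<gamma>" if "x \<in> carrier A" for x
    using that a generator_closed by (metis generator_commutes inv_solve_right')
  then show ?thesis
    using a by (auto simp: translate_def delta_config_def)
qed

text \<open>Translating by \<open>a\<close> puts the only nontrivial value of \<open>\<delta>\<^sub>\<gamma>\<^sup>b\<close> at the new position, and
  multiplying by \<open>\<one>\<close> changes nothing elsewhere, so the product is a function update.\<close>

lemma wreath_mult_delta:
  assumes "group B" and a: "a \<in> carrier A" and \<Phi>: "\<Phi> \<in> (\<Pi>\<^sub>E x\<in>carrier A. carrier B)"
  shows "(a, \<Phi>) \<otimes>\<^bsub>wreath_product A B\<^esub> (\<gamma>, delta_config A B \<gamma> b) =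
    (a \<otimes> \<gamma>, \<Phi>(a \<otimes> \<gamma> := \<Phi> (a \<otimes> \<gamma>) \<otimes>\<^bsub>B\<^esub> b))"
proof -
  interpret B: group B by fact
  have "(\<lambda>x\<in>carrier A. \<Phi> x \<otimes>\<^bsub>B\<^esub> delta_config A B (a \<otimes> \<gamma>) b x) =
    \<Phi>(a \<otimes> \<gamma> := \<Phi> (a \<otimes> \<gamma>) \<otimes>\<^bsub>B\<^esub> b)" (is "?l = ?r")
  proof
    fix x show "?l x = ?r x"
      using a \<Phi> generator_closed by (auto simp: delta_config_def PiE_iff extensional_def)
  qed
  then show ?thesis
    by (simp add: wreath_product_def config_group_def translate_delta_generator[OF a])
qed

end

section \<open>The wreath product and the circular slider\<close>

theorem theorem8p1:
  fixes A :: "('a, 'm) monoid_scheme" and B :: "('b, 'n) monoid_scheme"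
    and \<gamma> :: 'a and K :: "'b set"
  assumes "group A" and "finite (carrier A)"
    and "\<gamma> \<in> carrier A" and "generate A {\<gamma>} = carrier A"
    and "group B" and "K \<subseteq> carrier B"
  shows "digraph_iso
    (cayley_digraph (wreath_product A B) ((\<lambda>b. (\<gamma>, delta_config A B \<gamma> b)) ` K))
    (tensor_product (cayley_digraph A {\<gamma>}) (circular_slider B K (order A)))"
proof -
  interpret generated_finite_group A \<gamma>
    using assms by (simp add: generated_finite_group_def generated_finite_group_axioms_def)
  interpret B: group B by fact
  let ?G = "cayley_digraph (wreath_product A B) ((\<lambda>b. (\<gamma>, delta_config A B \<gamma> b)) ` K)"
  let ?H = "tensor_product (cayley_digraph A {\<gamma>}) (circular_slider B K (order A))"
  let ?F = "\<Pi>\<^sub>E x\<in>carrier A. carrier B"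
  let ?V = "{gs. length gs = order A \<and> set gs \<subseteq> carrier B}"
  let ?S = "(\<lambda>b. (\<gamma>, delta_config A B \<gamma> b)) ` K"
  define f :: "'a \<times> ('a \<Rightarrow> 'b) \<Rightarrow> 'a \<times> 'b list"
    where "f = (\<lambda>(a, \<Phi>). (a, orbit_word A \<gamma> (a \<otimes>\<^bsub>A\<^esub> \<gamma>) \<Phi>))"
  \<comment> \<open>The label \<open>b\<close> of an arc is recovered from the configuration \<open>\<delta>\<^sub>\<gamma>\<^sup>b\<close> by evaluating at \<open>\<gamma>\<close>.\<close>
  define g :: "('a \<times> ('a \<Rightarrow> 'b)) \<times> 'a \<times> ('a \<Rightarrow> 'b) \<Rightarrow> ('a \<times> 'a) \<times> 'b list \<times> 'b"
    where "g = (\<lambda>(v, c, \<Delta>). ((fst (f v), c), (snd (f v), \<Delta> \<gamma>)))"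
  have vG: "verts ?G = carrier A \<times> ?F" and aG: "arcs ?G = (carrier A \<times> ?F) \<times> ?S"
    by (simp_all add: cayley_digraph_def wreath_product_def config_group_def)
  have vH: "verts ?H = carrier A \<times> ?V"
    and aH: "arcs ?H = (carrier A \<times> {\<gamma>}) \<times> (?V \<times> K)"
    by (simp_all add: tensor_product_def cayley_digraph_def circular_slider_def Let_def)
  have delta: "delta_config A B \<gamma> b \<gamma> = b" for b
    using generator_closed by (simp add: delta_config_def)
  have head: "head ?G ((a, \<Phi>), (\<gamma>, delta_config A B \<gamma> b)) =
      (a \<otimes>\<^bsub>A\<^esub> \<gamma>, \<Phi>(a \<otimes>\<^bsub>A\<^esub> \<gamma> := \<Phi> (a \<otimes>\<^bsub>A\<^esub> \<gamma>) \<otimes>\<^bsub>B\<^esub> b))"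
    if "a \<in> carrier A" "\<Phi> \<in> ?F" for a \<Phi> b
    using wreath_mult_delta[OF \<open>group B\<close> that] by (simp add: cayley_digraph_def)
  have word: "bij_betw (orbit_word A \<gamma> (a \<otimes>\<^bsub>A\<^esub> \<gamma>)) ?F ?V" if "a \<in> carrier A" for a
    using that generator_closed by (intro bij_betw_orbit_word) simp
  have f_bij: "bij_betw f (carrier A \<times> ?F) (carrier A \<times> ?V)"
  proof (rule bij_betw_imageI)
    show "inj_on f (carrier A \<times> ?F)"
      using word by (auto simp: inj_on_def f_def bij_betw_def)
    show "f ` (carrier A \<times> ?F) = carrier A \<times> ?V"
    proof (intro equalityI subsetI)
      fix p assume "p \<in> f ` (carrier A \<times> ?F)"
      then show "p \<in> carrier A \<times> ?V"
        using bij_betw_apply[OF word] by (fastforce simp: f_def)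
    next
      fix p assume "p \<in> carrier A \<times> ?V"
      then obtain a gs where p: "p = (a, gs)" "a \<in> carrier A" "gs \<in> ?V" by blast
      then have "gs \<in> orbit_word A \<gamma> (a \<otimes>\<^bsub>A\<^esub> \<gamma>) ` ?F"
        using word[of a] by (simp add: bij_betw_def)
      then show "p \<in> f ` (carrier A \<times> ?F)"
        using p(1,2) by (force simp: f_def)
    qed
  qed
  show ?thesis
  proof (rule digraph_isoI)
    show "wf_digraph ?G"
    proof
      fix e assume "e \<in> arcs ?G"
      then obtain a \<Phi> b where e: "e = ((a, \<Phi>), (\<gamma>, delta_config A B \<gamma> b))"
        "a \<in> carrier A" "\<Phi> \<in> ?F" "b \<in> K"
        unfolding aG by blast
      show "tail ?G e \<in> verts ?G"
        unfolding vG using e by (simp add: cayley_digraph_def)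
      have site: "a \<otimes>\<^bsub>A\<^esub> \<gamma> \<in> carrier A"
        using e generator_closed by simp
      then have "\<Phi> (a \<otimes>\<^bsub>A\<^esub> \<gamma>) \<otimes>\<^bsub>B\<^esub> b \<in> carrier B"
        using PiE_mem[OF e(3) site] e(4) assms(6) by auto
      from PiE_fun_upd[OF this e(3)]
      have "\<Phi>(a \<otimes>\<^bsub>A\<^esub> \<gamma> := \<Phi> (a \<otimes>\<^bsub>A\<^esub> \<gamma>) \<otimes>\<^bsub>B\<^esub> b) \<in> ?F"
        by (metis site insert_absorb)
      then show "head ?G e \<in> verts ?G"
        unfolding vG e(1) head[OF e(2,3)] using site by simp
    qed
    show "bij_betw f (verts ?G) (verts ?H)"
      unfolding vG vH by (rule f_bij)
    show "bij_betw g (arcs ?G) (arcs ?H)"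
      unfolding aG aH
    proof (rule bij_betw_imageI)
      show "inj_on g ((carrier A \<times> ?F) \<times> ?S)"
      proof (rule inj_onI)
        fix d e assume d: "d \<in> (carrier A \<times> ?F) \<times> ?S" and e: "e \<in> (carrier A \<times> ?F) \<times> ?S"
          and eq: "g d = g e"
        have "f (fst d) = f (fst e)" "snd (snd d) \<gamma> = snd (snd e) \<gamma>"
          using eq by (auto simp: g_def split_beta prod_eq_iff)
        moreover from this(1) have "fst d = fst e"
          using d e inj_onD[OF bij_betw_imp_inj_on[OF f_bij]] by auto
        ultimately show "d = e"
          using d e by (auto simp: delta)
      qed
      show "g ` ((carrier A \<times> ?F) \<times> ?S) = (carrier A \<times> {\<gamma>}) \<times> (?V \<times> K)"
      proof (intro equalityI subsetI)
        fix q assume "q \<in> g ` ((carrier A \<times> ?F) \<times> ?S)"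
        then obtain v b where q: "q = g (v, \<gamma>, delta_config A B \<gamma> b)"
          and v: "v \<in> carrier A \<times> ?F" and b: "b \<in> K" by blast
        show "q \<in> (carrier A \<times> {\<gamma>}) \<times> (?V \<times> K)"
          using bij_betw_apply[OF f_bij v] b by (auto simp: q g_def delta mem_Times_iff)
      next
        fix q assume "q \<in> (carrier A \<times> {\<gamma>}) \<times> (?V \<times> K)"
        then obtain a gs b where q: "q = ((a, \<gamma>), (gs, b))"
          and m: "(a, gs) \<in> carrier A \<times> ?V" and b: "b \<in> K" by blast
        from m obtain v where v: "v \<in> carrier A \<times> ?F" and "f v = (a, gs)"
          using f_bij unfolding bij_betw_def by (metis (no_types, lifting) imageE)
        then have "q = g (v, \<gamma>, delta_config A B \<gamma> b)"
          by (simp add: q g_def delta)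
        then show "q \<in> g ` ((carrier A \<times> ?F) \<times> ?S)"
          using v b by blast
      qed
    qed
  next
    fix e assume "e \<in> arcs ?G"
    then obtain a \<Phi> b where e: "e = ((a, \<Phi>), (\<gamma>, delta_config A B \<gamma> b))"
      "a \<in> carrier A" "\<Phi> \<in> ?F"
      unfolding aG by blast
    show "f (tail ?G e) = tail ?H (g e)"
      by (simp add: e f_def g_def cayley_digraph_def tensor_product_def circular_slider_def Let_def)
    have site: "a \<otimes>\<^bsub>A\<^esub> \<gamma> \<in> carrier A"
      using e generator_closed by simp
    have "head ?H (g e) = (a \<otimes>\<^bsub>A\<^esub> \<gamma>,
        tl (orbit_word A \<gamma> (a \<otimes>\<^bsub>A\<^esub> \<gamma>) \<Phi>) @ [hd (orbit_word A \<gamma> (a \<otimes>\<^bsub>A\<^esub> \<gamma>) \<Phi>) \<otimes>\<^bsub>B\<^esub> b])"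
      by (simp add: e f_def g_def delta cayley_digraph_def tensor_product_def
          circular_slider_def Let_def)
    then show "f (head ?G e) = head ?H (g e)"
      unfolding e(1) head[OF e(2,3)]
      by (simp add: f_def orbit_word_step[OF site] hd_orbit_word[OF site])
  qed
qed

end
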